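(* Let $A$ be an associative algebra over a field $\mathbb{K}$ and let $(r,s)$ be an associative Yang-Baxter pair on $A$. Define $\delta_r,\delta_s,\Delta:A\to A\otimes A$ by $$\delta_r(a)=ar-ra,\qquad \delta_s(a)=as-sa,\qquad \Delta(a)=ar-sa.$$ Then $(A,\delta_r,\delta_s,\Delta)$ is a covariant bialgebra (called the quasitriangular covariant bialgebra associated to $(r,s)$). Furthermore, if $f:A\to B$ is an algebra map and $(r^f,s^f)$, with $r^f=(f\otimes f)(r)$ and $s^f=(f\otimes f)(s)$, is the associative Yang-Baxter pair in $B$ induced by $f$, then $f$ is a morphism of covariant bialgebras from the quasitriangular covariant bialgebra associated to $(r,s)$ to the one associated to $(r^f,s^f)$.
   Context: Algebras are associative, not necessarily unital, over a field $\mathbb{K}$; $\otimes=\otimes_{\mathbb{K}}$. $A\otimes A$ is an $A$-bimodule by $a\cdot(b\otimes c)\cdot d=ab\otimes cd$. For $r=\sum_i a_i\otimes b_i\in A\otimes A$ put $r_{12}=r\otimes 1$, $r_{13}=\sum_i a_i\otimes 1\otimes b_i$, $r_{23}=1\otimes r$, where $1$ is the identity of $A$ if $A$ is unital, or the identity of the extended unital algebra $\mathbb{K}\oplus A$ otherwise. An associative Yang-Baxter pair on $A$ is a pair $r,s\in A\otimes A$ such that $$r_{13}r_{12}-r_{12}r_{23}+s_{23}r_{13}=0,\qquad s_{13}r_{12}-s_{12}s_{23}+s_{23}s_{13}=0.$$ A derivation $\delta:A\to A\otimes A$ is a $\mathbb{K}$-linear map with $\delta(ab)=a\delta(b)+\delta(a)b$.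 A covariant bialgebra is a quadruple $(A,\delta_1,\delta_2,\Delta)$ such that $A$ is an associative algebra, $\delta_1,\delta_2:A\to A\otimes A$ are derivations, and $\Delta:A\to A\otimes A$ is a $\mathbb{K}$-linear coassociative map (no counit is required) that is a covariant derivation with respect to $(\delta_1,\delta_2)$, i.e. for all $a,b\in A$, $$\Delta(ab)=\Delta(a)b+a\delta_1(b)=a\Delta(b)+\delta_2(a)b.$$ A morphism of covariant bialgebras is a $\mathbb{K}$-linear map that is both an algebra map and a coalgebra map (i.e. $\Delta_B\circ f=(f\otimes f)\circ\Delta_A$). *)

theory Defs
  imports Complex_Main "HOL-Library.Poly_Mapping" "HOL-Library.Set_Algebras"
    "HOL-Library.Product_Plus"
begin

section \<open>Algebras\<close>

text \<open>
  The scalar multiplication and the product are parameters, since both the tensor products and the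
  unitization below depend on them. There is no unit.
\<close>

locale assoc_algebra = vector_space scale
  for scale :: "'k::field \<Rightarrow> 'a::ab_group_add \<Rightarrow> 'a" +
  fixes mult :: "'a \<Rightarrow> 'a \<Rightarrow> 'a"
  assumes mult_assoc: "mult (mult a b) c = mult a (mult b c)"
    and mult_add_left: "mult (a + b) c = mult a c + mult b c"
    and mult_add_right: "mult a (b + c) = mult a b + mult a c"
    and mult_scale_left: "mult (scale k a) b = scale k (mult a b)"
    and mult_scale_right: "mult a (scale k b) = scale k (mult a b)"

definition is_identity :: "('a \<Rightarrow> 'a \<Rightarrow> 'a) \<Rightarrow> 'a \<Rightarrow> bool" where
  "is_identity mult e \<longleftrightarrow> (\<forall>a. mult e a = a \<and> mult a e = a)"

definition algebra_map ::
    "('k::field \<Rightarrow> 'a::ab_group_add \<Rightarrow> 'a) \<Rightarrow> ('a \<Rightarrow> 'a \<Rightarrow> 'a) \<Rightarrow>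
     ('k \<Rightarrow> 'b::ab_group_add \<Rightarrow> 'b) \<Rightarrow> ('b \<Rightarrow> 'b \<Rightarrow> 'b) \<Rightarrow> ('a \<Rightarrow> 'b) \<Rightarrow> bool" where
  "algebra_map scA mA scB mB f \<longleftrightarrow>
     Vector_Spaces.linear scA scB f \<and> (\<forall>a b. f (mA a b) = mB (f a) (f b))"

text \<open>The extended unital algebra on \<open>K \<oplus> A\<close>, with identity \<open>(1, 0)\<close>.\<close>

fun unitization_scale ::
    "('k::field \<Rightarrow> 'a \<Rightarrow> 'a) \<Rightarrow> 'k \<Rightarrow> 'k \<times> 'a \<Rightarrow> 'k \<times> 'a" where
  "unitization_scale scale c (k, a) = (c * k, scale c a)"

fun unitization_mult ::
    "('k::field \<Rightarrow> 'a::ab_group_add \<Rightarrow> 'a) \<Rightarrow> ('a \<Rightarrow> 'a \<Rightarrow> 'a) \<Rightarrow>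
     'k \<times> 'a \<Rightarrow> 'k \<times> 'a \<Rightarrow> 'k \<times> 'a" where
  "unitization_mult scale mult (k, a) (l, b) = (k * l, scale k b + scale l a + mult a b)"


section \<open>Free vector spaces and their quotients\<close>

text \<open>\<^typ>\<open>'i \<Rightarrow>\<^sub>0 'k\<close> is the free vector space on \<^typ>\<open>'i\<close>.\<close>

definition free_scale :: "'k::field \<Rightarrow> ('i \<Rightarrow>\<^sub>0 'k) \<Rightarrow> ('i \<Rightarrow>\<^sub>0 'k)" where
  "free_scale c x = Poly_Mapping.map ((*) c) x"

abbreviation basis :: "'i \<Rightarrow> ('i \<Rightarrow>\<^sub>0 'k::field)" where
  "basis i \<equiv> Poly_Mapping.single i 1"

definition free_extend :: "('i \<Rightarrow> ('j \<Rightarrow>\<^sub>0 'k)) \<Rightarrow> ('i \<Rightarrow>\<^sub>0 'k::field) \<Rightarrow> ('j \<Rightarrow>\<^sub>0 'k)" where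
  "free_extend g x = (\<Sum>i\<in>Poly_Mapping.keys x. free_scale (Poly_Mapping.lookup x i) (g i))"

text \<open>
  An element of the quotient by a subspace \<open>N\<close> is a coset \<open>x +o N\<close>. Operations on cosets are defined
  on a chosen representative; wherever they are used below, the result does not depend on the
  choice. (The overloaded \<open>+\<close> and \<open>-\<close> on sets are deliberately avoided: \<open>-\<close> is set difference.)
\<close>

definition rep :: "'v set \<Rightarrow> 'v" where
  "rep X = (SOME x. x \<in> X)"

definition qzero :: "'v::ab_group_add set \<Rightarrow> 'v set" where
  "qzero N = 0 +o N"

definition qplus :: "'v::ab_group_add set \<Rightarrow> 'v set \<Rightarrow> 'v set \<Rightarrow> 'v set" where
  "qplus N X Y = (rep X + rep Y) +o N"

definition qminus :: "'v::ab_group_add set \<Rightarrow> 'v set \<Rightarrow> 'v set \<Rightarrow> 'v set" where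
  "qminus N X Y = (rep X - rep Y) +o N"

definition qscale ::
    "('i \<Rightarrow>\<^sub>0 'k::field) set \<Rightarrow> 'k \<Rightarrow> ('i \<Rightarrow>\<^sub>0 'k) set \<Rightarrow> ('i \<Rightarrow>\<^sub>0 'k) set" where
  "qscale N c X = free_scale c (rep X) +o N"


section \<open>The tensor products of two and of three copies of a vector space\<close>

type_synonym ('a, 'k) tensor2 = "(('a \<times> 'a) \<Rightarrow>\<^sub>0 'k) set"
type_synonym ('a, 'k) tensor3 = "(('a \<times> 'a \<times> 'a) \<Rightarrow>\<^sub>0 'k) set"

definition rel2 ::
    "('k::field \<Rightarrow> 'a::ab_group_add \<Rightarrow> 'a) \<Rightarrow> (('a \<times> 'a) \<Rightarrow>\<^sub>0 'k) set" where
  "rel2 scale = module.span free_scale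
    ({basis (a + a', b) - basis (a, b) - basis (a', b) | a a' b. True} \<union>
     {basis (a, b + b') - basis (a, b) - basis (a, b') | a b b'. True} \<union>
     {basis (scale c a, b) - free_scale c (basis (a, b)) | c a b. True} \<union>
     {basis (a, scale c b) - free_scale c (basis (a, b)) | c a b. True})"

definition rel3 ::
    "('k::field \<Rightarrow> 'a::ab_group_add \<Rightarrow> 'a) \<Rightarrow> (('a \<times> 'a \<times> 'a) \<Rightarrow>\<^sub>0 'k) set" where
  "rel3 scale = module.span free_scale
    ({basis (a + a', b, c) - basis (a, b, c) - basis (a', b, c) | a a' b c. True} \<union>
     {basis (a, b + b', c) - basis (a, b, c) - basis (a, b', c) | a b b' c. True} \<union>
     {basis (a, b, c + c') - basis (a, b, c) - basis (a, b, c') | a b c c'. True} \<union>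
     {basis (scale k a, b, c) - free_scale k (basis (a, b, c)) | k a b c. True} \<union>
     {basis (a, scale k b, c) - free_scale k (basis (a, b, c)) | k a b c. True} \<union>
     {basis (a, b, scale k c) - free_scale k (basis (a, b, c)) | k a b c. True})"

definition tensor_space2 ::
    "('k::field \<Rightarrow> 'a::ab_group_add \<Rightarrow> 'a) \<Rightarrow> ('a, 'k) tensor2 set" where
  "tensor_space2 scale = range (\<lambda>x. x +o rel2 scale)"

text \<open>\<open>a \<cdot> X\<close> and \<open>X \<cdot> d\<close> for the bimodule structure \<open>a \<cdot> (b \<otimes> c) \<cdot> d = ab \<otimes> cd\<close>.\<close>

definition lact ::
    "('k::field \<Rightarrow> 'a::ab_group_add \<Rightarrow> 'a) \<Rightarrow> ('a \<Rightarrow> 'a \<Rightarrow> 'a) \<Rightarrow>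
     'a \<Rightarrow> ('a, 'k) tensor2 \<Rightarrow> ('a, 'k) tensor2" where
  "lact scale mult a X =
     free_extend (\<lambda>(b, c). basis (mult a b, c)) (rep X) +o rel2 scale"

definition ract ::
    "('k::field \<Rightarrow> 'a::ab_group_add \<Rightarrow> 'a) \<Rightarrow> ('a \<Rightarrow> 'a \<Rightarrow> 'a) \<Rightarrow>
     ('a, 'k) tensor2 \<Rightarrow> 'a \<Rightarrow> ('a, 'k) tensor2" where
  "ract scale mult X d =
     free_extend (\<lambda>(b, c). basis (b, mult c d)) (rep X) +o rel2 scale"

text \<open>\<open>f \<otimes> f\<close>; the scalar multiplication is that of the codomain of \<open>f\<close>.\<close>

definition tensor_map2 ::
    "('k::field \<Rightarrow> 'b::ab_group_add \<Rightarrow> 'b) \<Rightarrow> ('a \<Rightarrow> 'b) \<Rightarrow>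
     ('a, 'k) tensor2 \<Rightarrow> ('b, 'k) tensor2" where
  "tensor_map2 scB f X = free_extend (\<lambda>(a, b). basis (f a, f b)) (rep X) +o rel2 scB"

text \<open>The componentwise product of \<open>A \<otimes> A \<otimes> A\<close>.\<close>

definition mult3 ::
    "('k::field \<Rightarrow> 'a::ab_group_add \<Rightarrow> 'a) \<Rightarrow> ('a \<Rightarrow> 'a \<Rightarrow> 'a) \<Rightarrow>
     ('a, 'k) tensor3 \<Rightarrow> ('a, 'k) tensor3 \<Rightarrow> ('a, 'k) tensor3" where
  "mult3 scale mult X Y =
     free_extend (\<lambda>(a, b, c).
       free_extend (\<lambda>(a', b', c'). basis (mult a a', mult b b', mult c c')) (rep Y)) (rep X)
     +o rel3 scale"


section \<open>Associative Yang-Baxter pairs\<close>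

definition leg12 ::
    "('k::field \<Rightarrow> 'a::ab_group_add \<Rightarrow> 'a) \<Rightarrow> 'a \<Rightarrow> ('a, 'k) tensor2 \<Rightarrow> ('a, 'k) tensor3" where
  "leg12 scale e r = free_extend (\<lambda>(a, b). basis (a, b, e)) (rep r) +o rel3 scale"

definition leg13 ::
    "('k::field \<Rightarrow> 'a::ab_group_add \<Rightarrow> 'a) \<Rightarrow> 'a \<Rightarrow> ('a, 'k) tensor2 \<Rightarrow> ('a, 'k) tensor3" where
  "leg13 scale e r = free_extend (\<lambda>(a, b). basis (a, e, b)) (rep r) +o rel3 scale"

definition leg23 ::
    "('k::field \<Rightarrow> 'a::ab_group_add \<Rightarrow> 'a) \<Rightarrow> 'a \<Rightarrow> ('a, 'k) tensor2 \<Rightarrow> ('a, 'k) tensor3" where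
  "leg23 scale e r = free_extend (\<lambda>(a, b). basis (e, a, b)) (rep r) +o rel3 scale"

definition yang_baxter_equations ::
    "('k::field \<Rightarrow> 'a::ab_group_add \<Rightarrow> 'a) \<Rightarrow> ('a \<Rightarrow> 'a \<Rightarrow> 'a) \<Rightarrow> 'a \<Rightarrow>
     ('a, 'k) tensor2 \<Rightarrow> ('a, 'k) tensor2 \<Rightarrow> bool" where
  "yang_baxter_equations scale mult e r s \<longleftrightarrow>
    (let N = rel3 scale; m = mult3 scale mult;
         r12 = leg12 scale e r; r13 = leg13 scale e r; r23 = leg23 scale e r;
         s12 = leg12 scale e s; s13 = leg13 scale e s; s23 = leg23 scale e s
     in qplus N (qminus N (m r13 r12) (m r12 r23)) (m s23 r13) = qzero N \<and>
        qplus N (qminus N (m s13 r12) (m s12 s23)) (m s23 s13) = qzero N)"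

definition assoc_yang_baxter_pair ::
    "('k::field \<Rightarrow> 'a::ab_group_add \<Rightarrow> 'a) \<Rightarrow> ('a \<Rightarrow> 'a \<Rightarrow> 'a) \<Rightarrow>
     ('a, 'k) tensor2 \<Rightarrow> ('a, 'k) tensor2 \<Rightarrow> bool" where
  "assoc_yang_baxter_pair scale mult r s \<longleftrightarrow>
     r \<in> tensor_space2 scale \<and> s \<in> tensor_space2 scale \<and>
     (if \<exists>e. is_identity mult e
      then yang_baxter_equations scale mult (THE e. is_identity mult e) r s
      else let scale' = unitization_scale scale; mult' = unitization_mult scale mult;
               \<iota> = tensor_map2 scale' (\<lambda>a. (0, a))
           in yang_baxter_equations scale' mult' (1, 0) (\<iota> r) (\<iota> s))"


section \<open>Covariant bialgebras\<close>

definition linear_to_tensor2 ::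
    "('k::field \<Rightarrow> 'a::ab_group_add \<Rightarrow> 'a) \<Rightarrow> ('a \<Rightarrow> ('a, 'k) tensor2) \<Rightarrow> bool" where
  "linear_to_tensor2 scale \<delta> \<longleftrightarrow>
     (\<forall>a. \<delta> a \<in> tensor_space2 scale) \<and>
     (\<forall>a b. \<delta> (a + b) = qplus (rel2 scale) (\<delta> a) (\<delta> b)) \<and>
     (\<forall>c a. \<delta> (scale c a) = qscale (rel2 scale) c (\<delta> a))"

definition derivation ::
    "('k::field \<Rightarrow> 'a::ab_group_add \<Rightarrow> 'a) \<Rightarrow> ('a \<Rightarrow> 'a \<Rightarrow> 'a) \<Rightarrow>
     ('a \<Rightarrow> ('a, 'k) tensor2) \<Rightarrow> bool" where
  "derivation scale mult \<delta> \<longleftrightarrow>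
     linear_to_tensor2 scale \<delta> \<and>
     (\<forall>a b. \<delta> (mult a b) =
        qplus (rel2 scale) (lact scale mult a (\<delta> b)) (ract scale mult (\<delta> a) b))"

definition comult_id ::
    "('k::field \<Rightarrow> 'a::ab_group_add \<Rightarrow> 'a) \<Rightarrow> ('a \<Rightarrow> ('a, 'k) tensor2) \<Rightarrow>
     ('a, 'k) tensor2 \<Rightarrow> ('a, 'k) tensor3" where
  "comult_id scale \<Delta> X =
     free_extend (\<lambda>(a, b). free_extend (\<lambda>(u, v). basis (u, v, b)) (rep (\<Delta> a))) (rep X)
     +o rel3 scale"

definition id_comult ::
    "('k::field \<Rightarrow> 'a::ab_group_add \<Rightarrow> 'a) \<Rightarrow> ('a \<Rightarrow> ('a, 'k) tensor2) \<Rightarrow>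
     ('a, 'k) tensor2 \<Rightarrow> ('a, 'k) tensor3" where
  "id_comult scale \<Delta> X =
     free_extend (\<lambda>(a, b). free_extend (\<lambda>(u, v). basis (a, u, v)) (rep (\<Delta> b))) (rep X)
     +o rel3 scale"

definition coassociative ::
    "('k::field \<Rightarrow> 'a::ab_group_add \<Rightarrow> 'a) \<Rightarrow> ('a \<Rightarrow> ('a, 'k) tensor2) \<Rightarrow> bool" where
  "coassociative scale \<Delta> \<longleftrightarrow>
     linear_to_tensor2 scale \<Delta> \<and>
     (\<forall>a. comult_id scale \<Delta> (\<Delta> a) = id_comult scale \<Delta> (\<Delta> a))"

locale covariant_bialgebra = assoc_algebra scale mult
  for scale :: "'k::field \<Rightarrow> 'a::ab_group_add \<Rightarrow> 'a" and mult :: "'a \<Rightarrow> 'a \<Rightarrow> 'a" +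
  fixes \<delta>\<^sub>1 \<delta>\<^sub>2 \<Delta> :: "'a \<Rightarrow> ('a, 'k) tensor2"
  assumes derivation_1: "derivation scale mult \<delta>\<^sub>1"
    and derivation_2: "derivation scale mult \<delta>\<^sub>2"
    and coassociative: "coassociative scale \<Delta>"
    and covariant_1: "\<Delta> (mult a b) =
      qplus (rel2 scale) (ract scale mult (\<Delta> a) b) (lact scale mult a (\<delta>\<^sub>1 b))"
    and covariant_2: "\<Delta> (mult a b) =
      qplus (rel2 scale) (lact scale mult a (\<Delta> b)) (ract scale mult (\<delta>\<^sub>2 a) b)"

definition covariant_bialgebra_morphism ::
    "('k::field \<Rightarrow> 'a::ab_group_add \<Rightarrow> 'a) \<Rightarrow> ('a \<Rightarrow> 'a \<Rightarrow> 'a) \<Rightarrow>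
     ('a \<Rightarrow> ('a, 'k) tensor2) \<Rightarrow> ('a \<Rightarrow> ('a, 'k) tensor2) \<Rightarrow> ('a \<Rightarrow> ('a, 'k) tensor2) \<Rightarrow>
     ('k \<Rightarrow> 'b::ab_group_add \<Rightarrow> 'b) \<Rightarrow> ('b \<Rightarrow> 'b \<Rightarrow> 'b) \<Rightarrow>
     ('b \<Rightarrow> ('b, 'k) tensor2) \<Rightarrow> ('b \<Rightarrow> ('b, 'k) tensor2) \<Rightarrow> ('b \<Rightarrow> ('b, 'k) tensor2) \<Rightarrow>
     ('a \<Rightarrow> 'b) \<Rightarrow> bool" where
  "covariant_bialgebra_morphism scA mA \<delta>\<^sub>1 \<delta>\<^sub>2 \<Delta> scB mB \<epsilon>\<^sub>1 \<epsilon>\<^sub>2 \<Theta> f \<longleftrightarrow>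
     covariant_bialgebra scA mA \<delta>\<^sub>1 \<delta>\<^sub>2 \<Delta> \<and> covariant_bialgebra scB mB \<epsilon>\<^sub>1 \<epsilon>\<^sub>2 \<Theta> \<and>
     algebra_map scA mA scB mB f \<and> (\<forall>a. \<Theta> (f a) = tensor_map2 scB f (\<Delta> a))"

definition quasitriangular_comult ::
    "('k::field \<Rightarrow> 'a::ab_group_add \<Rightarrow> 'a) \<Rightarrow> ('a \<Rightarrow> 'a \<Rightarrow> 'a) \<Rightarrow>
     ('a, 'k) tensor2 \<Rightarrow> ('a, 'k) tensor2 \<Rightarrow> 'a \<Rightarrow> ('a, 'k) tensor2" where
  "quasitriangular_comult scale mult r s a =
     qminus (rel2 scale) (lact scale mult a r) (ract scale mult s a)"

definition inner_derivation ::
    "('k::field \<Rightarrow> 'a::ab_group_add \<Rightarrow> 'a) \<Rightarrow> ('a \<Rightarrow> 'a \<Rightarrow> 'a) \<Rightarrow>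
     ('a, 'k) tensor2 \<Rightarrow> 'a \<Rightarrow> ('a, 'k) tensor2" where
  "inner_derivation scale mult r a =
     qminus (rel2 scale) (lact scale mult a r) (ract scale mult r a)"

end

theory Submission
  imports Defs
begin

text \<open>
  The computations take place on representatives in the free vector spaces, where
  \<^const>\<open>free_extend\<close> behaves like a monadic bind. Written out, the two Yang-Baxter equations
  involve products of elements of \<open>A\<close> only, never the unit, so they live in \<open>A \<otimes> A \<otimes> A\<close>; the
  unitization is harmless because \<open>A \<rightarrow> K \<oplus> A\<close> has a linear retraction. In this unit-free form they
  are preserved by arbitrary algebra maps, unital or not, and the coassociator of \<open>\<Delta>\<close> at \<open>a\<close> is
  \<open>a\<close> times the first left-hand side minus the second left-hand side times \<open>a\<close>.
\<close>

section \<open>The free vector space\<close>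

lemma lookup_free_scale [simp]:
  "Poly_Mapping.lookup (free_scale c x) i = c * Poly_Mapping.lookup x i"
  by (simp add: free_scale_def Poly_Mapping.map.rep_eq when_def)

text \<open>Makes the library on spans and subspaces available:
  \<open>module.span free_scale\<close>, used to define the tensor relations, is now
  \<open>free.span\<close>.\<close>

interpretation free: vector_space free_scale
  by standard (auto intro!: poly_mapping_eqI simp: lookup_add algebra_simps)

text \<open>Sums over different supports become comparable once zero terms extend them to a common
  finite index set.\<close>

lemma free_extend_superset:
  assumes "finite S" "Poly_Mapping.keys x \<subseteq> S"
  shows "free_extend g x = (\<Sum>i\<in>S. free_scale (Poly_Mapping.lookup x i) (g i))"
  unfolding free_extend_def
  by (rule sum.mono_neutral_left) (use assms in \<open>auto simp: in_keys_iff\<close>)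

lemma free_extend_add: "free_extend g (x + y) = free_extend g x + free_extend g y"
proof -
  let ?S = "Poly_Mapping.keys x \<union> Poly_Mapping.keys y"
  have "Poly_Mapping.keys (x + y) \<subseteq> ?S"
    by (rule Poly_Mapping.keys_add)
  then show ?thesis
    by (simp add: free_extend_superset[where S = ?S] lookup_add free.scale_left_distrib
        sum.distrib)
qed

lemma free_extend_scale: "free_extend g (free_scale c x) = free_scale c (free_extend g x)"
proof -
  have "Poly_Mapping.keys (free_scale c x) \<subseteq> Poly_Mapping.keys x"
    by (auto simp: in_keys_iff)
  then show ?thesis
    by (simp add: free_extend_superset[where S = "Poly_Mapping.keys x"] free.scale_sum_right)
qed

lemma free_extend_diff: "free_extend g (x - y) = free_extend g x - free_extend g y"
proof -
  have "free_extend g (x - y) + free_extend g y = free_extend g x"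
    by (simp flip: free_extend_add)
  then show ?thesis
    by (simp add: algebra_simps)
qed

lemma free_extend_zero: "free_extend g 0 = 0"
  by (simp add: free_extend_def)

lemma free_extend_sum: "free_extend g (\<Sum>i\<in>I. h i) = (\<Sum>i\<in>I. free_extend g (h i))"
  by (induction I rule: infinite_finite_induct) (simp_all add: free_extend_add free_extend_zero)

lemma free_extend_basis: "free_extend g (basis i) = g i"
  by (simp add: free_extend_def)

lemma free_extend_bind:
  "free_extend g (free_extend h x) = free_extend (\<lambda>i. free_extend g (h i)) x"
  by (simp add: free_extend_def[of h] free_extend_def[of "\<lambda>i. free_extend g (h i)"]
      free_extend_sum free_extend_scale)

lemma free_extend_add_fun:
  "free_extend (\<lambda>i. g i + h i) x = free_extend g x + free_extend h x"
  by (simp add: free_extend_def free.scale_right_distrib sum.distrib)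

lemma free_extend_diff_fun:
  "free_extend (\<lambda>i. g i - h i) x = free_extend g x - free_extend h x"
  by (simp add: free_extend_def free.scale_right_diff_distrib sum_subtractf)

lemma free_extend_scale_fun:
  "free_extend (\<lambda>i. free_scale c (g i)) x = free_scale c (free_extend g x)"
  by (simp add: free_extend_def free.scale_sum_right mult.commute)

text \<open>Fubini for double sums. As a rewrite rule it could loop, so it stays out of
  \<open>free_extend_simps\<close> and is applied to particular instances.\<close>

lemma free_extend_swap:
  "free_extend (\<lambda>i. free_extend (g i) y) x = free_extend (\<lambda>j. free_extend (\<lambda>i. g i j) x) y"
  unfolding free_extend_def free.scale_sum_right
  by (subst sum.swap) (simp add: mult.commute)

lemma free_extend_id: "free_extend basis x = x"
proof -
  have "Poly_Mapping.lookup (free_extend basis x) k = Poly_Mapping.lookup x k" for k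
    by (auto simp: free_extend_def lookup_sum lookup_single when_def in_keys_iff if_distrib
        cong: if_cong)
  then show ?thesis
    by (rule poly_mapping_eqI)
qed

lemmas free_extend_simps =
  free_extend_add free_extend_scale free_extend_diff free_extend_basis free_extend_bind
  free_extend_add_fun free_extend_diff_fun free_extend_scale_fun

text \<open>Together with \<open>free_extend_diff_fun\<close> and
  \<open>free_extend_scale_fun\<close> read from right to left, this reduces a congruence modulo
  \<open>N\<close> between extensions to the same congruence at each index.\<close>

lemma free_extend_mem:
  assumes "free.subspace N" "\<And>i. g i \<in> N"
  shows "free_extend g x \<in> N"
  unfolding free_extend_def
  by (intro free.subspace_sum free.subspace_scale assms)

text \<open>The preimage of a subspace under a linear map is a subspace, so it contains the span of
  \<open>G\<close> as soon as it contains \<open>G\<close>.\<close>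

lemma free_extend_span:
  assumes "free.subspace N" "\<And>z. z \<in> G \<Longrightarrow> free_extend g z \<in> N" "x \<in> free.span G"
  shows "free_extend g x \<in> N"
  using assms(3)
proof (induction rule: free.span_induct)
  case base
  then show ?case
    using assms(1)
    by (auto simp: free.subspace_def free_extend_add free_extend_scale free_extend_zero)
qed (rule assms(2))


section \<open>Cosets\<close>

lemma coset_eq_iff:
  assumes "free.subspace N"
  shows "x +o N = y +o N \<longleftrightarrow> x - y \<in> N"
proof
  assume "x +o N = y +o N"
  moreover have "x \<in> x +o N"
    using free.subspace_0[OF assms] by (force simp: elt_set_plus_def)
  ultimately show "x - y \<in> N"
    by (auto simp: elt_set_plus_def)
next
  assume *: "x - y \<in> N"
  show "x +o N = y +o N"
  proof (intro set_eqI iffI)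
    fix z
    assume "z \<in> x +o N"
    then obtain n where "n \<in> N" "z = x + n"
      by (auto simp: elt_set_plus_def)
    then have "z = y + ((x - y) + n)" "(x - y) + n \<in> N"
      using * free.subspace_add[OF assms] by auto
    then show "z \<in> y +o N"
      unfolding elt_set_plus_def by blast
  next
    fix z
    assume "z \<in> y +o N"
    then obtain n where "n \<in> N" "z = y + n"
      by (auto simp: elt_set_plus_def)
    then have "z = x + (n - (x - y))" "n - (x - y) \<in> N"
      using * free.subspace_diff[OF assms] by auto
    then show "z \<in> x +o N"
      unfolding elt_set_plus_def by blast
  qed
qed

lemma coset_eq_qzero_iff: "free.subspace N \<Longrightarrow> x +o N = qzero N \<longleftrightarrow> x \<in> N"
  using coset_eq_iff[of N x 0] by (simp add: qzero_def)

lemma coset_in_tensor_space2: "x +o rel2 scale \<in> tensor_space2 scale"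
  by (auto simp: tensor_space2_def)

lemma rep_coset:
  assumes "free.subspace N"
  shows "rep (x +o N) - x \<in> N"
proof -
  have "x \<in> x +o N"
    using free.subspace_0[OF assms] by (force simp: elt_set_plus_def)
  then have "rep (x +o N) \<in> x +o N"
    unfolding rep_def by (rule someI)
  then show ?thesis
    by (auto simp: elt_set_plus_def)
qed

lemma qplus_coset:
  assumes "free.subspace N"
  shows "qplus N (x +o N) (y +o N) = (x + y) +o N"
proof -
  have "(rep (x +o N) + rep (y +o N)) - (x + y) = (rep (x +o N) - x) + (rep (y +o N) - y)"
    by simp
  also have "\<dots> \<in> N"
    by (intro free.subspace_add rep_coset assms)
  finally show ?thesis
    unfolding qplus_def by (simp only: coset_eq_iff[OF assms])
qed

lemma qminus_coset:
  assumes "free.subspace N"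
  shows "qminus N (x +o N) (y +o N) = (x - y) +o N"
proof -
  have "(rep (x +o N) - rep (y +o N)) - (x - y) = (rep (x +o N) - x) - (rep (y +o N) - y)"
    by simp
  also have "\<dots> \<in> N"
    by (intro free.subspace_diff rep_coset assms)
  finally show ?thesis
    unfolding qminus_def by (simp only: coset_eq_iff[OF assms])
qed

lemma qscale_coset:
  assumes "free.subspace N"
  shows "qscale N c (x +o N) = free_scale c x +o N"
proof -
  have "free_scale c (rep (x +o N)) - free_scale c x = free_scale c (rep (x +o N) - x)"
    by (simp add: free.scale_right_diff_distrib)
  also have "\<dots> \<in> N"
    by (intro free.subspace_scale rep_coset assms)
  finally show ?thesis
    unfolding qscale_def by (simp only: coset_eq_iff[OF assms])
qed


section \<open>Multilinearity modulo a subspace\<close>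

lemma subspace_rel2: "free.subspace (rel2 scale)"
  unfolding rel2_def by (rule free.subspace_span)

lemma subspace_rel3: "free.subspace (rel3 scale)"
  unfolding rel3_def by (rule free.subspace_span)

lemmas coset_simps =
  qplus_coset[OF subspace_rel2] qminus_coset[OF subspace_rel2] qscale_coset[OF subspace_rel2]
  qplus_coset[OF subspace_rel3] qminus_coset[OF subspace_rel3]

text \<open>Bilinearity of the induced map into the quotient by \<open>N\<close>, phrased on
  representatives: the four clauses mirror the four families of generators of
  \<open>rel2\<close>.\<close>

definition bilinear_mod ::
    "('k::field \<Rightarrow> 'a::ab_group_add \<Rightarrow> 'a) \<Rightarrow> ('j \<Rightarrow>\<^sub>0 'k) set \<Rightarrow> ('a \<times> 'a \<Rightarrow> ('j \<Rightarrow>\<^sub>0 'k)) \<Rightarrow> bool"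
  where "bilinear_mod scale N g \<longleftrightarrow>
    (\<forall>a a' b. g (a + a', b) - g (a, b) - g (a', b) \<in> N) \<and>
    (\<forall>a b b'. g (a, b + b') - g (a, b) - g (a, b') \<in> N) \<and>
    (\<forall>c a b. g (scale c a, b) - free_scale c (g (a, b)) \<in> N) \<and>
    (\<forall>c a b. g (a, scale c b) - free_scale c (g (a, b)) \<in> N)"

definition trilinear_mod ::
    "('k::field \<Rightarrow> 'a::ab_group_add \<Rightarrow> 'a) \<Rightarrow> ('j \<Rightarrow>\<^sub>0 'k) set \<Rightarrow>
     ('a \<times> 'a \<times> 'a \<Rightarrow> ('j \<Rightarrow>\<^sub>0 'k)) \<Rightarrow> bool"
  where "trilinear_mod scale N g \<longleftrightarrow>
    (\<forall>a a' b c. g (a + a', b, c) - g (a, b, c) - g (a', b, c) \<in> N) \<and>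
    (\<forall>a b b' c. g (a, b + b', c) - g (a, b, c) - g (a, b', c) \<in> N) \<and>
    (\<forall>a b c c'. g (a, b, c + c') - g (a, b, c) - g (a, b, c') \<in> N) \<and>
    (\<forall>k a b c. g (scale k a, b, c) - free_scale k (g (a, b, c)) \<in> N) \<and>
    (\<forall>k a b c. g (a, scale k b, c) - free_scale k (g (a, b, c)) \<in> N) \<and>
    (\<forall>k a b c. g (a, b, scale k c) - free_scale k (g (a, b, c)) \<in> N)"

lemma rel2_intros:
  "basis (a + a', b) - basis (a, b) - basis (a', b) \<in> rel2 scale"
  "basis (a, b + b') - basis (a, b) - basis (a, b') \<in> rel2 scale"
  "basis (scale k a, b) - free_scale k (basis (a, b)) \<in> rel2 scale"
  "basis (a, scale k b) - free_scale k (basis (a, b)) \<in> rel2 scale"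
  unfolding rel2_def
  subgoal by (rule free.span_base, rule UnI1, rule UnI1, rule UnI1, blast)
  subgoal by (rule free.span_base, rule UnI1, rule UnI1, rule UnI2, blast)
  subgoal by (rule free.span_base, rule UnI1, rule UnI2, blast)
  subgoal by (rule free.span_base, rule UnI2, blast)
  done

lemma rel3_intros:
  "basis (a + a', b, c) - basis (a, b, c) - basis (a', b, c) \<in> rel3 scale"
  "basis (a, b + b', c) - basis (a, b, c) - basis (a, b', c) \<in> rel3 scale"
  "basis (a, b, c + c') - basis (a, b, c) - basis (a, b, c') \<in> rel3 scale"
  "basis (scale k a, b, c) - free_scale k (basis (a, b, c)) \<in> rel3 scale"
  "basis (a, scale k b, c) - free_scale k (basis (a, b, c)) \<in> rel3 scale"
  "basis (a, b, scale k c) - free_scale k (basis (a, b, c)) \<in> rel3 scale"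
  unfolding rel3_def
  subgoal by (rule free.span_base, rule UnI1, rule UnI1, rule UnI1, rule UnI1, rule UnI1, blast)
  subgoal by (rule free.span_base, rule UnI1, rule UnI1, rule UnI1, rule UnI1, rule UnI2, blast)
  subgoal by (rule free.span_base, rule UnI1, rule UnI1, rule UnI1, rule UnI2, blast)
  subgoal by (rule free.span_base, rule UnI1, rule UnI1, rule UnI2, blast)
  subgoal by (rule free.span_base, rule UnI1, rule UnI2, blast)
  subgoal by (rule free.span_base, rule UnI2, blast)
  done

text \<open>The universal property of the tensor square on representatives. It is what makes
  operations defined through \<open>rep\<close> independent of the choice.\<close>

lemma bilinear_mod_rel2:
  assumes "free.subspace N" "bilinear_mod scale N g" "x \<in> rel2 scale"
  shows "free_extend g x \<in> N"
  using assms(1) _ assms(3)[unfolded rel2_def]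
  by (rule free_extend_span) (use assms(2) in \<open>auto simp: bilinear_mod_def free_extend_simps\<close>)

lemma trilinear_mod_rel3:
  assumes "free.subspace N" "trilinear_mod scale N g" "x \<in> rel3 scale"
  shows "free_extend g x \<in> N"
  using assms(1) _ assms(3)[unfolded rel3_def]
  by (rule free_extend_span) (use assms(2) in \<open>auto simp: trilinear_mod_def free_extend_simps\<close>)

lemma free_extend_rep_rel2:
  assumes "free.subspace N" "bilinear_mod scale N g"
  shows "free_extend g (rep (x +o rel2 scale)) - free_extend g x \<in> N"
  using bilinear_mod_rel2[OF assms rep_coset[OF subspace_rel2]] by (simp add: free_extend_diff)

lemma free_extend_rep_rel3:
  assumes "free.subspace N" "trilinear_mod scale N g"
  shows "free_extend g (rep (x +o rel3 scale)) - free_extend g x \<in> N"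
  using trilinear_mod_rel3[OF assms rep_coset[OF subspace_rel3]] by (simp add: free_extend_diff)

lemma free_extend_coset2:
  assumes "free.subspace N" "bilinear_mod scale N g"
  shows "free_extend g (rep (x +o rel2 scale)) +o N = free_extend g x +o N"
  using free_extend_rep_rel2[OF assms] by (simp only: coset_eq_iff[OF assms(1)])

lemma free_extend_cong_mod:
  assumes "free.subspace N" "\<And>i. g i - h i \<in> N"
  shows "free_extend g x - free_extend h x \<in> N"
  using free_extend_mem[OF assms(1), of "\<lambda>i. g i - h i"] assms(2)
  by (simp add: free_extend_diff_fun)

text \<open>Serves the case where \<open>g\<close> involves the unspecified
  \<open>rep (\<Delta> a)\<close>: bilinearity is checked for an explicit \<open>h\<close> and
  carries over because the errors \<open>g i - h i\<close> lie in \<open>N\<close>.\<close>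

lemma bilinear_mod_cong:
  assumes N: "free.subspace N" and gh: "\<And>i. g i - h i \<in> N" and h: "bilinear_mod scale N h"
  shows "bilinear_mod scale N g"
proof -
  have add: "g i - g j - g k \<in> N" if "h i - h j - h k \<in> N" for i j k
  proof -
    have "g i - g j - g k = (g i - h i) - (g j - h j) - (g k - h k) + (h i - h j - h k)"
      by simp
    also have "\<dots> \<in> N"
      by (intro free.subspace_add free.subspace_diff N gh that)
    finally show ?thesis .
  qed
  have scale: "g i - free_scale c (g j) \<in> N" if "h i - free_scale c (h j) \<in> N" for c i j
  proof -
    have "g i - free_scale c (g j)
        = (g i - h i) - free_scale c (g j - h j) + (h i - free_scale c (h j))"
      by (simp add: free.scale_right_diff_distrib)
    also have "\<dots> \<in> N"
      by (intro free.subspace_add free.subspace_diff free.subspace_scale N gh that)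
    finally show ?thesis .
  qed
  show ?thesis
    unfolding bilinear_mod_def
    by (intro conjI allI; (rule add | rule scale)) (use h in \<open>simp_all add: bilinear_mod_def\<close>)
qed

lemma trilinear_mod_free_extend:
  assumes "free.subspace N" "\<And>j. trilinear_mod scale N (\<lambda>p. h p j)"
  shows "trilinear_mod scale N (\<lambda>p. free_extend (h p) y)"
  unfolding trilinear_mod_def free_extend_diff_fun[symmetric] free_extend_scale_fun[symmetric]
  by (intro conjI allI; rule free_extend_mem[OF assms(1)])
    (use assms(2) in \<open>simp_all add: trilinear_mod_def\<close>)


section \<open>Operations on representatives\<close>

text \<open>Two separate maps, so that \<open>f \<otimes> f\<close> and the bimodule actions, which
  change one factor only, are all instances.\<close>

definition tmap2 ::
    "('a \<Rightarrow> 'b) \<Rightarrow> ('a \<Rightarrow> 'b) \<Rightarrow> ('a \<times> 'a \<Rightarrow>\<^sub>0 'k::field) \<Rightarrow> ('b \<times> 'b \<Rightarrow>\<^sub>0 'k)" where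
  "tmap2 f g = free_extend (\<lambda>(a, b). basis (f a, g b))"

definition tmap3 ::
    "('a \<Rightarrow> 'b) \<Rightarrow> ('a \<Rightarrow> 'b) \<Rightarrow> ('a \<Rightarrow> 'b) \<Rightarrow> ('a \<times> 'a \<times> 'a \<Rightarrow>\<^sub>0 'k::field) \<Rightarrow>
     ('b \<times> 'b \<times> 'b \<Rightarrow>\<^sub>0 'k)" where
  "tmap3 f g h = free_extend (\<lambda>(a, b, c). basis (f a, g b, h c))"

lemma bilinear_mod_tmap2:
  assumes "Vector_Spaces.linear scA scB f" "Vector_Spaces.linear scA scB g"
  shows "bilinear_mod scA (rel2 scB) (\<lambda>(a, b). basis (f a, g b))"
  using assms by (simp add: bilinear_mod_def Vector_Spaces.linear_iff rel2_intros)

lemma trilinear_mod_tmap3: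
  assumes "Vector_Spaces.linear scA scB f" "Vector_Spaces.linear scA scB g"
    "Vector_Spaces.linear scA scB h"
  shows "trilinear_mod scA (rel3 scB) (\<lambda>(a, b, c). basis (f a, g b, h c))"
  using assms by (simp add: trilinear_mod_def Vector_Spaces.linear_iff rel3_intros)

lemma tmap2_coset:
  assumes "Vector_Spaces.linear scA scB f" "Vector_Spaces.linear scA scB g"
  shows "tmap2 f g (rep (x +o rel2 scA)) +o rel2 scB = tmap2 f g x +o rel2 scB"
  unfolding tmap2_def by (rule free_extend_coset2[OF subspace_rel2 bilinear_mod_tmap2[OF assms]])

lemma tmap3_rel3:
  assumes "Vector_Spaces.linear scA scB f" "Vector_Spaces.linear scA scB g"
    "Vector_Spaces.linear scA scB h" "x \<in> rel3 scA"
  shows "tmap3 f g h x \<in> rel3 scB"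
  unfolding tmap3_def
  by (rule trilinear_mod_rel3[OF subspace_rel3 trilinear_mod_tmap3[OF assms(1-3)] assms(4)])

lemma tensor_map2_coset:
  assumes "Vector_Spaces.linear scA scB f"
  shows "tensor_map2 scB f (x +o rel2 scA) = tmap2 f f x +o rel2 scB"
  using tmap2_coset[OF assms assms] by (simp add: tensor_map2_def tmap2_def)

lemma leg12_coset:
  "leg12 scale e (x +o rel2 scale) = free_extend (\<lambda>(a, b). basis (a, b, e)) x +o rel3 scale"
  unfolding leg12_def
  by (rule free_extend_coset2[OF subspace_rel3]) (simp add: bilinear_mod_def rel3_intros)

lemma leg13_coset:
  "leg13 scale e (x +o rel2 scale) = free_extend (\<lambda>(a, b). basis (a, e, b)) x +o rel3 scale"
  unfolding leg13_def
  by (rule free_extend_coset2[OF subspace_rel3]) (simp add: bilinear_mod_def rel3_intros)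

lemma leg23_coset:
  "leg23 scale e (x +o rel2 scale) = free_extend (\<lambda>(a, b). basis (e, a, b)) x +o rel3 scale"
  unfolding leg23_def
  by (rule free_extend_coset2[OF subspace_rel3]) (simp add: bilinear_mod_def rel3_intros)

text \<open>In nested operations such as \<open>comult_id\<close> two choices have to be removed:
  the inner one by comparing \<open>g\<close> with \<open>h\<close> at each index, the outer one by
  bilinearity.\<close>

lemma free_extend_coset2_family:
  assumes N: "free.subspace N" and gh: "\<And>i. g i - h i \<in> N" and h: "bilinear_mod scale N h"
  shows "free_extend g (rep (x +o rel2 scale)) +o N = free_extend h x +o N"
proof -
  have "free_extend g (rep (x +o rel2 scale)) +o N = free_extend g x +o N"
    by (rule free_extend_coset2[OF N bilinear_mod_cong[OF N gh h]])
  also have "\<dots> = free_extend h x +o N"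
    using free_extend_cong_mod[OF N gh] by (simp only: coset_eq_iff[OF N])
  finally show ?thesis .
qed

text \<open>\<open>D\<close> is any family of representatives of the values of
  \<open>\<Delta>\<close>; linearity on cosets passes to \<open>D\<close> only modulo the
  relations.\<close>

lemma linear_to_tensor2_cosets:
  assumes "linear_to_tensor2 scale \<Delta>" "\<And>a. \<Delta> a = D a +o rel2 scale"
  shows "D (a + b) - D a - D b \<in> rel2 scale" "D (scale c a) - free_scale c (D a) \<in> rel2 scale"
  using assms(1)
  by (auto simp: linear_to_tensor2_def assms(2) coset_simps coset_eq_iff[OF subspace_rel2]
      algebra_simps)

lemma comult_id_coset:
  assumes "linear_to_tensor2 scale \<Delta>" and \<Delta>: "\<And>a. \<Delta> a = D a +o rel2 scale"
  shows "comult_id scale \<Delta> (x +o rel2 scale) =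
    free_extend (\<lambda>(a, b). free_extend (\<lambda>(u, v). basis (u, v, b)) (D a)) x +o rel3 scale"
  unfolding comult_id_def
proof (rule free_extend_coset2_family[OF subspace_rel3])
  have bilin: "bilinear_mod scale (rel3 scale) (\<lambda>(u, v). basis (u, v, b))" for b
    by (simp add: bilinear_mod_def rel3_intros)
  show "(case i of (a, b) \<Rightarrow> free_extend (\<lambda>(u, v). basis (u, v, b)) (rep (\<Delta> a)))
      - (case i of (a, b) \<Rightarrow> free_extend (\<lambda>(u, v). basis (u, v, b)) (D a)) \<in> rel3 scale" for i
    using free_extend_rep_rel2[OF subspace_rel3 bilin] by (simp add: \<Delta> split: prod.split)
  note D = linear_to_tensor2_cosets[OF assms]
  \<comment> \<open>Linearity in \<open>b\<close> comes from the third factor of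
    \<open>rel3\<close>; linearity in \<open>a\<close> comes from that of \<open>D\<close> modulo
    \<open>rel2\<close>.\<close>
  have add: "free_extend (\<lambda>(u, v). basis (u, v, b + b')) x
      - free_extend (\<lambda>(u, v). basis (u, v, b)) x
      - free_extend (\<lambda>(u, v). basis (u, v, b')) x \<in> rel3 scale" for b b' x
    unfolding free_extend_diff_fun[symmetric]
    by (rule free_extend_mem[OF subspace_rel3]) (simp add: split_def rel3_intros)
  have scale: "free_extend (\<lambda>(u, v). basis (u, v, scale c b)) x
      - free_scale c (free_extend (\<lambda>(u, v). basis (u, v, b)) x) \<in> rel3 scale" for c b x
    unfolding free_extend_diff_fun[symmetric] free_extend_scale_fun[symmetric]
    by (rule free_extend_mem[OF subspace_rel3]) (simp add: split_def rel3_intros)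
  show "bilinear_mod scale (rel3 scale)
      (\<lambda>(a, b). free_extend (\<lambda>(u, v). basis (u, v, b)) (D a))"
    using bilinear_mod_rel2[OF subspace_rel3 bilin D(1)]
      bilinear_mod_rel2[OF subspace_rel3 bilin D(2)] add scale
    by (simp add: bilinear_mod_def free_extend_diff free_extend_scale)
qed

lemma id_comult_coset:
  assumes "linear_to_tensor2 scale \<Delta>" and \<Delta>: "\<And>a. \<Delta> a = D a +o rel2 scale"
  shows "id_comult scale \<Delta> (x +o rel2 scale) =
    free_extend (\<lambda>(a, b). free_extend (\<lambda>(u, v). basis (a, u, v)) (D b)) x +o rel3 scale"
  unfolding id_comult_def
proof (rule free_extend_coset2_family[OF subspace_rel3])
  have bilin: "bilinear_mod scale (rel3 scale) (\<lambda>(u, v). basis (a, u, v))" for a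
    by (simp add: bilinear_mod_def rel3_intros)
  show "(case i of (a, b) \<Rightarrow> free_extend (\<lambda>(u, v). basis (a, u, v)) (rep (\<Delta> b)))
      - (case i of (a, b) \<Rightarrow> free_extend (\<lambda>(u, v). basis (a, u, v)) (D b)) \<in> rel3 scale" for i
    using free_extend_rep_rel2[OF subspace_rel3 bilin] by (simp add: \<Delta> split: prod.split)
  note D = linear_to_tensor2_cosets[OF assms]
  have add: "free_extend (\<lambda>(u, v). basis (a + a', u, v)) x
      - free_extend (\<lambda>(u, v). basis (a, u, v)) x
      - free_extend (\<lambda>(u, v). basis (a', u, v)) x \<in> rel3 scale" for a a' x
    unfolding free_extend_diff_fun[symmetric]
    by (rule free_extend_mem[OF subspace_rel3]) (auto simp: rel3_intros split: prod.split)
  have scale: "free_extend (\<lambda>(u, v). basis (scale c a, u, v)) x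
      - free_scale c (free_extend (\<lambda>(u, v). basis (a, u, v)) x) \<in> rel3 scale" for c a x
    unfolding free_extend_diff_fun[symmetric] free_extend_scale_fun[symmetric]
    by (rule free_extend_mem[OF subspace_rel3]) (auto simp: rel3_intros split: prod.split)
  show "bilinear_mod scale (rel3 scale)
      (\<lambda>(a, b). free_extend (\<lambda>(u, v). basis (a, u, v)) (D b))"
    using bilinear_mod_rel2[OF subspace_rel3 bilin D(1)]
      bilinear_mod_rel2[OF subspace_rel3 bilin D(2)] add scale
    by (simp add: bilinear_mod_def free_extend_diff free_extend_scale)
qed


section \<open>The unit-free form of the Yang-Baxter equations\<close>

text \<open>\<open>u\<^sub>1\<^sub>3r\<^sub>1\<^sub>2 - u\<^sub>1\<^sub>2u\<^sub>2\<^sub>3 + s\<^sub>2\<^sub>3u\<^sub>1\<^sub>3\<close>; the two equations are the cases \<open>u = r\<close> and \<open>u = s\<close>.\<close>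

definition yb ::
    "('a \<Rightarrow> 'a \<Rightarrow> 'a) \<Rightarrow> ('a \<times> 'a \<Rightarrow>\<^sub>0 'k::field) \<Rightarrow> ('a \<times> 'a \<Rightarrow>\<^sub>0 'k) \<Rightarrow> ('a \<times> 'a \<Rightarrow>\<^sub>0 'k) \<Rightarrow>
     ('a \<times> 'a \<times> 'a \<Rightarrow>\<^sub>0 'k)" where
  "yb m r s u =
     free_extend (\<lambda>(a, b). free_extend (\<lambda>(c, d). basis (m a c, d, b)) r) u
     - free_extend (\<lambda>(a, b). free_extend (\<lambda>(c, d). basis (a, m b c, d)) u) u
     + free_extend (\<lambda>(a, b). free_extend (\<lambda>(c, d). basis (a, c, m d b)) s) u"

text \<open>Every term of \<open>yb\<close> is a double sum of basis triples of products, so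
  \<open>f\<close> passes inside entry by entry. The identity holds in the free vector space itself,
  before any quotient.\<close>

lemma tmap3_yb:
  assumes "\<And>a b. f (mA a b) = mB (f a) (f b)"
  shows "tmap3 f f f (yb mA r s u) = yb mB (tmap2 f f r) (tmap2 f f s) (tmap2 f f u)"
  by (simp add: yb_def tmap2_def tmap3_def split_def free_extend_simps assms)

context assoc_algebra
begin

lemma linear_mult_left: "Vector_Spaces.linear scale scale (mult a)"
  by (simp add: Vector_Spaces.linear_iff vector_space_axioms mult_add_right mult_scale_right)

lemma linear_mult_right: "Vector_Spaces.linear scale scale (\<lambda>b. mult b a)"
  by (simp add: Vector_Spaces.linear_iff vector_space_axioms mult_add_left mult_scale_left)

lemma lact_coset:
  "lact scale mult a (x +o rel2 scale) = tmap2 (mult a) (\<lambda>b. b) x +o rel2 scale"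
  using tmap2_coset[OF linear_mult_left linear_ident] by (simp add: lact_def tmap2_def)

lemma ract_coset:
  "ract scale mult (x +o rel2 scale) a = tmap2 (\<lambda>b. b) (\<lambda>c. mult c a) x +o rel2 scale"
  using tmap2_coset[OF linear_ident linear_mult_right] by (simp add: ract_def tmap2_def)

lemma mult3_coset:
  "mult3 scale mult (x +o rel3 scale) (y +o rel3 scale) =
    free_extend (\<lambda>(a, b, c). free_extend (\<lambda>(a', b', c').
      basis (mult a a', mult b b', mult c c')) y) x +o rel3 scale"
proof -
  let ?h = "\<lambda>(a, b, c) (a', b', c'). basis (mult a a', mult b b', mult c c')"
  let ?y = "rep (y +o rel3 scale)"
  \<comment> \<open>The representatives are exchanged one at a time: that of \<open>y\<close> inside
    the outer sum, then that of \<open>x\<close>.\<close>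
  have right: "free_extend (?h p) ?y - free_extend (?h p) y \<in> rel3 scale" for p
    by (rule free_extend_rep_rel3[OF subspace_rel3])
      (simp add: split_def trilinear_mod_def mult_add_right mult_scale_right rel3_intros)
  have "trilinear_mod scale (rel3 scale) (\<lambda>p. free_extend (?h p) y)"
    by (rule trilinear_mod_free_extend[OF subspace_rel3])
      (simp add: split_def trilinear_mod_def mult_add_left mult_scale_left rel3_intros)
  then have left: "free_extend (\<lambda>p. free_extend (?h p) y) (rep (x +o rel3 scale))
      - free_extend (\<lambda>p. free_extend (?h p) y) x \<in> rel3 scale"
    by (rule free_extend_rep_rel3[OF subspace_rel3])
  have "free_extend (\<lambda>p. free_extend (?h p) ?y) (rep (x +o rel3 scale))
      - free_extend (\<lambda>p. free_extend (?h p) y) (rep (x +o rel3 scale)) \<in> rel3 scale"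
    by (rule free_extend_cong_mod[OF subspace_rel3 right])
  from free.subspace_add[OF subspace_rel3 this left]
  have "free_extend (\<lambda>p. free_extend (?h p) ?y) (rep (x +o rel3 scale))
      - free_extend (\<lambda>p. free_extend (?h p) y) x \<in> rel3 scale"
    by simp
  then show ?thesis
    by (simp add: mult3_def coset_eq_iff[OF subspace_rel3] split_def)
qed

text \<open>When the legs are multiplied out, each \<open>e\<close> meets an element of the algebra
  and disappears, leaving exactly the products in \<open>yb\<close>.\<close>

lemma yang_baxter_equations_iff:
  assumes "is_identity mult e"
  shows "yang_baxter_equations scale mult e (x +o rel2 scale) (y +o rel2 scale) \<longleftrightarrow>
    yb mult x y x \<in> rel3 scale \<and> yb mult x y y \<in> rel3 scale"
proof -
  have e [simp]: "mult e a = a" "mult a e = a" for a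
    using assms by (simp_all add: is_identity_def)
  \<comment> \<open>The products with \<open>s23\<close> on the left sum over \<open>s\<close>
    outermost, whereas the last term of \<open>yb\<close> has that sum innermost.\<close>
  have swap: "free_extend (\<lambda>p. free_extend (\<lambda>q. basis (fst q, fst p, mult (snd p) (snd q))) u) y
      = free_extend (\<lambda>q. free_extend (\<lambda>p. basis (fst q, fst p, mult (snd p) (snd q))) y) u"
    for u :: "'a \<times> 'a \<Rightarrow>\<^sub>0 'k"
    by (rule free_extend_swap)
  show ?thesis
    by (simp add: yang_baxter_equations_def Let_def leg12_coset leg13_coset leg23_coset
        mult3_coset coset_simps coset_eq_qzero_iff[OF subspace_rel3] yb_def split_def
        free_extend_simps swap)
qed

lemma assoc_algebra_unitization:
  "assoc_algebra (unitization_scale scale) (unitization_mult scale mult)"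
  by standard
    (auto simp: mult_assoc mult_add_left mult_add_right mult_scale_left mult_scale_right
      algebra_simps)

lemma is_identity_unitization: "is_identity (unitization_mult scale mult) (1, 0)"
proof -
  have "mult 0 a = 0" "mult a 0 = 0" for a
    using mult_add_left[of 0 0 a] mult_add_right[of a 0 0] by simp_all
  then show ?thesis
    by (auto simp: is_identity_def)
qed

text \<open>Both branches of the definition reduce to one unit-free criterion, so unital and
  nonunital algebras are treated alike from here on.\<close>

lemma assoc_yang_baxter_pair_iff:
  "assoc_yang_baxter_pair scale mult (x +o rel2 scale) (y +o rel2 scale) \<longleftrightarrow>
    yb mult x y x \<in> rel3 scale \<and> yb mult x y y \<in> rel3 scale"
proof (cases "\<exists>e. is_identity mult e")
  case True
  then obtain e where e: "is_identity mult e"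
    by blast
  moreover have "e' = e" if "is_identity mult e'" for e'
    using e that unfolding is_identity_def by metis
  ultimately have "(THE e. is_identity mult e) = e"
    by (rule the_equality)
  then show ?thesis
    using e True
    by (simp add: assoc_yang_baxter_pair_def coset_in_tensor_space2 yang_baxter_equations_iff)
next
  case False
  let ?scale = "unitization_scale scale" and ?mult = "unitization_mult scale mult"
  let ?i = "\<lambda>a. (0 :: 'k, a :: 'a)"
  interpret U: assoc_algebra ?scale ?mult
    by (rule assoc_algebra_unitization)
  have zero: "mult 0 a = 0" for a
    using mult_add_left[of 0 0 a] by simp
  \<comment> \<open>Membership in the relations is pushed forward along the inclusion and brought
    back along \<open>snd\<close>. The projection \<open>snd\<close> is not multiplicative in
    general; \<open>tmap3_rel3\<close> uses its linearity.\<close>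
  have i: "Vector_Spaces.linear scale ?scale ?i" and snd: "Vector_Spaces.linear ?scale scale snd"
    by (auto simp: Vector_Spaces.linear_iff vector_space_axioms U.vector_space_axioms)
  have hom: "?i (mult a b) = ?mult (?i a) (?i b)" for a b
    by simp
  have retract: "tmap3 snd snd snd (tmap3 ?i ?i ?i z) = z" for z :: "'a \<times> 'a \<times> 'a \<Rightarrow>\<^sub>0 'k"
    by (simp add: tmap3_def split_def free_extend_simps free_extend_id)
  have "yb ?mult (tmap2 ?i ?i x) (tmap2 ?i ?i y) (tmap2 ?i ?i u) \<in> rel3 ?scale
      \<longleftrightarrow> yb mult x y u \<in> rel3 scale" for u
    unfolding tmap3_yb[of ?i mult ?mult, OF hom, symmetric]
    using tmap3_rel3[OF i i i] tmap3_rel3[OF snd snd snd, of "tmap3 ?i ?i ?i (yb mult x y u)"]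
    by (auto simp: retract)
  then show ?thesis
    using False
    by (simp add: assoc_yang_baxter_pair_def coset_in_tensor_space2 Let_def tensor_map2_coset[OF i]
        U.yang_baxter_equations_iff[OF is_identity_unitization])
qed


section \<open>Quasitriangular covariant bialgebras\<close>

text \<open>An explicit representative of \<open>a r - s a\<close>, to be used as the family
  \<open>D\<close> in \<open>comult_id_coset\<close> and \<open>id_comult_coset\<close>.\<close>

definition comult_rep ::
    "('a \<times> 'a \<Rightarrow>\<^sub>0 'k) \<Rightarrow> ('a \<times> 'a \<Rightarrow>\<^sub>0 'k) \<Rightarrow> 'a \<Rightarrow> ('a \<times> 'a \<Rightarrow>\<^sub>0 'k)" where
  "comult_rep x y a = tmap2 (mult a) (\<lambda>b. b) x - tmap2 (\<lambda>b. b) (\<lambda>c. mult c a) y"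

lemma quasitriangular_comult_coset:
  "quasitriangular_comult scale mult (x +o rel2 scale) (y +o rel2 scale) a =
    comult_rep x y a +o rel2 scale"
  by (simp add: quasitriangular_comult_def lact_coset ract_coset coset_simps comult_rep_def)

text \<open>Lets the results on \<open>quasitriangular_comult\<close>, linearity above all, cover
  both inner derivations.\<close>

lemma inner_derivation_eq: "inner_derivation scale mult r = quasitriangular_comult scale mult r r"
  by (rule ext) (simp add: inner_derivation_def quasitriangular_comult_def)

lemma linear_quasitriangular_comult:
  "linear_to_tensor2 scale
    (quasitriangular_comult scale mult (x +o rel2 scale) (y +o rel2 scale))"
proof -
  have "tmap2 (mult (a + b)) (\<lambda>b. b) x - tmap2 (mult a) (\<lambda>b. b) x - tmap2 (mult b) (\<lambda>b. b) x
      \<in> rel2 scale" for a b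
    unfolding tmap2_def free_extend_diff_fun[symmetric]
    by (rule free_extend_mem[OF subspace_rel2]) (simp add: split_def mult_add_left rel2_intros)
  moreover have "tmap2 (\<lambda>b. b) (\<lambda>c. mult c (a + b)) y - tmap2 (\<lambda>b. b) (\<lambda>c. mult c a) y
      - tmap2 (\<lambda>b. b) (\<lambda>c. mult c b) y \<in> rel2 scale" for a b
    unfolding tmap2_def free_extend_diff_fun[symmetric]
    by (rule free_extend_mem[OF subspace_rel2]) (simp add: split_def mult_add_right rel2_intros)
  ultimately have add: "comult_rep x y (a + b) - comult_rep x y a - comult_rep x y b
      \<in> rel2 scale" for a b
    using free.subspace_diff[OF subspace_rel2[of scale]]
    by (fastforce simp: comult_rep_def algebra_simps)
  have "tmap2 (mult (scale c a)) (\<lambda>b. b) x - free_scale c (tmap2 (mult a) (\<lambda>b. b) x)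
      \<in> rel2 scale" for c a
    unfolding tmap2_def free_extend_diff_fun[symmetric] free_extend_scale_fun[symmetric]
    by (rule free_extend_mem[OF subspace_rel2]) (simp add: split_def mult_scale_left rel2_intros)
  moreover have "tmap2 (\<lambda>b. b) (\<lambda>d. mult d (scale c a)) y
      - free_scale c (tmap2 (\<lambda>b. b) (\<lambda>d. mult d a) y) \<in> rel2 scale" for c a
    unfolding tmap2_def free_extend_diff_fun[symmetric] free_extend_scale_fun[symmetric]
    by (rule free_extend_mem[OF subspace_rel2]) (simp add: split_def mult_scale_right rel2_intros)
  ultimately have scale: "comult_rep x y (scale c a) - free_scale c (comult_rep x y a)
      \<in> rel2 scale" for c a
    using free.subspace_diff[OF subspace_rel2[of scale]]
    by (fastforce simp: comult_rep_def algebra_simps free.scale_right_diff_distrib)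
  show ?thesis
    using add scale
    by (simp add: linear_to_tensor2_def quasitriangular_comult_coset
        coset_in_tensor_space2 coset_simps coset_eq_iff[OF subspace_rel2] diff_diff_eq)
qed

text \<open>Expanding \<open>a r - s a\<close> twice gives four double sums on each side. The sum
  with \<open>a\<close> in the middle factor occurs on both and cancels; the three with
  \<open>a\<close> in the first factor form the first Yang-Baxter expression, the three with
  \<open>a\<close> in the last factor the second, negated.\<close>

lemma coassociator_eq:
  "free_extend (\<lambda>(b, c). free_extend (\<lambda>(u, v). basis (u, v, c)) (comult_rep x y b))
      (comult_rep x y a)
    - free_extend (\<lambda>(b, c). free_extend (\<lambda>(u, v). basis (b, u, v)) (comult_rep x y c))
      (comult_rep x y a)
    = tmap3 (mult a) (\<lambda>b. b) (\<lambda>b. b) (yb mult x y x)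
      - tmap3 (\<lambda>b. b) (\<lambda>b. b) (\<lambda>b. mult b a) (yb mult x y y)"
proof -
  \<comment> \<open>The cancelling sum: the two iterated coproducts produce it with opposite
    nesting.\<close>
  have "free_extend (\<lambda>p. free_extend
        (\<lambda>q. basis (fst q, mult (snd q) (mult a (fst p)), snd p)) y) x
      = free_extend (\<lambda>q. free_extend
        (\<lambda>p. basis (fst q, mult (snd q) (mult a (fst p)), snd p)) x) y"
    by (rule free_extend_swap)
  \<comment> \<open>Both sums run over \<open>y\<close> here; the iterated coproduct and the middle
    term of \<open>yb\<close> nest them in opposite order.\<close>
  moreover have "free_extend (\<lambda>p. free_extend
        (\<lambda>q. basis (fst q, mult (snd q) (fst p), mult (snd p) a)) y) y
      = free_extend (\<lambda>q. free_extend
        (\<lambda>p. basis (fst q, mult (snd q) (fst p), mult (snd p) a)) y) y"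
    by (rule free_extend_swap)
  ultimately show ?thesis
    by (simp add: comult_rep_def yb_def tmap2_def tmap3_def split_def free_extend_simps mult_assoc
        algebra_simps)
qed

lemma covariant_bialgebra_quasitriangular:
  assumes "assoc_yang_baxter_pair scale mult r s"
  shows "covariant_bialgebra scale mult (inner_derivation scale mult r)
    (inner_derivation scale mult s) (quasitriangular_comult scale mult r s)"
proof -
  obtain x y where r: "r = x +o rel2 scale" and s: "s = y +o rel2 scale"
    using assms by (auto simp: assoc_yang_baxter_pair_def tensor_space2_def)
  have yb: "yb mult x y x \<in> rel3 scale" "yb mult x y y \<in> rel3 scale"
    using assms by (simp_all add: r s assoc_yang_baxter_pair_iff)
  \<comment> \<open>Generalised over \<open>x\<close> and \<open>y\<close>, so that it also rewrites
    the inner derivations, where the two tensors coincide.\<close>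
  have cosets: "quasitriangular_comult scale mult (x +o rel2 scale) (y +o rel2 scale) a =
      comult_rep x y a +o rel2 scale" for x y a
    by (rule quasitriangular_comult_coset)
  note simps = inner_derivation_eq cosets lact_coset ract_coset coset_simps
    comult_rep_def tmap2_def split_def free_extend_simps mult_assoc
  show ?thesis
    unfolding r s
  proof unfold_locales
    \<comment> \<open>The Leibniz rule telescopes: \<open>a z b\<close> cancels between
      \<open>a (b z - z b)\<close> and \<open>(a z - z a) b\<close>.\<close>
    show "derivation scale mult (inner_derivation scale mult (z +o rel2 scale))" for z
      unfolding derivation_def
      by (intro conjI allI, simp add: inner_derivation_eq linear_quasitriangular_comult)
        (simp add: simps)
    then show "derivation scale mult (inner_derivation scale mult (y +o rel2 scale))" .
    \<comment> \<open>By \<open>coassociator_eq\<close> this is the coassociator; acting by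
      \<open>a\<close> on an outer factor preserves the relations.\<close>
    have "tmap3 (mult a) (\<lambda>b. b) (\<lambda>b. b) (yb mult x y x)
        - tmap3 (\<lambda>b. b) (\<lambda>b. b) (\<lambda>b. mult b a) (yb mult x y y) \<in> rel3 scale" for a
      by (intro free.subspace_diff subspace_rel3
          tmap3_rel3[OF linear_mult_left linear_ident linear_ident]
          tmap3_rel3[OF linear_ident linear_ident linear_mult_right] yb)
    then show "coassociative scale
        (quasitriangular_comult scale mult (x +o rel2 scale) (y +o rel2 scale))"
      using linear_quasitriangular_comult[of x y]
      by (simp add: coassociative_def cosets
          comult_id_coset[OF linear_quasitriangular_comult cosets]
          id_comult_coset[OF linear_quasitriangular_comult cosets] coset_eq_iff[OF subspace_rel3]
          coassociator_eq)
  \<comment> \<open>In the two covariance laws \<open>a r b\<close>, respectively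
    \<open>a s b\<close>, cancels, leaving \<open>(ab) r - s (ab)\<close>.\<close>
  qed (simp_all add: simps)
qed

end

section \<open>Functoriality along algebra maps\<close>

lemma assoc_yang_baxter_pair_map:
  assumes A: "assoc_algebra scA mA" and B: "assoc_algebra scB mB"
    and f: "algebra_map scA mA scB mB f"
    and rs: "assoc_yang_baxter_pair scA mA r s"
  shows "assoc_yang_baxter_pair scB mB (tensor_map2 scB f r) (tensor_map2 scB f s)"
proof -
  interpret A: assoc_algebra scA mA by (rule A)
  interpret B: assoc_algebra scB mB by (rule B)
  obtain x y where r: "r = x +o rel2 scA" and s: "s = y +o rel2 scA"
    using rs by (auto simp: assoc_yang_baxter_pair_def tensor_space2_def)
  have lin: "Vector_Spaces.linear scA scB f" and hom: "f (mA a b) = mB (f a) (f b)" for a b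
    using f by (simp_all add: algebra_map_def)
  \<comment> \<open>The two algebras may fall into different branches of the definition, and
    \<open>f\<close> may fail to preserve an identity. The unit-free criterion on both sides leaves
    only the transport of \<open>yb\<close> and of the relations.\<close>
  show ?thesis
    using rs tmap3_rel3[OF lin lin lin]
    by (simp add: r s tensor_map2_coset[OF lin] A.assoc_yang_baxter_pair_iff
        B.assoc_yang_baxter_pair_iff flip: tmap3_yb[of f mA mB, OF hom])
qed

text \<open>Multiplicativity of \<open>f\<close> makes both sides agree already on
  representatives.\<close>

lemma quasitriangular_comult_map:
  assumes A: "assoc_algebra scA mA" and B: "assoc_algebra scB mB"
    and f: "algebra_map scA mA scB mB f"
    and r: "r \<in> tensor_space2 scA" and s: "s \<in> tensor_space2 scA"
  shows "quasitriangular_comult scB mB (tensor_map2 scB f r) (tensor_map2 scB f s) (f a) =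
    tensor_map2 scB f (quasitriangular_comult scA mA r s a)"
proof -
  interpret A: assoc_algebra scA mA by (rule A)
  interpret B: assoc_algebra scB mB by (rule B)
  obtain x y where r: "r = x +o rel2 scA" and s: "s = y +o rel2 scA"
    using r s by (auto simp: tensor_space2_def)
  have lin: "Vector_Spaces.linear scA scB f" and hom: "f (mA a b) = mB (f a) (f b)" for a b
    using f by (simp_all add: algebra_map_def)
  show ?thesis
    by (simp add: r s tensor_map2_coset[OF lin] A.quasitriangular_comult_coset
        B.quasitriangular_comult_coset A.comult_rep_def B.comult_rep_def tmap2_def split_def
        free_extend_simps hom)
qed

theorem corollary3p17:
  fixes scA :: "'k::field \<Rightarrow> 'a::ab_group_add \<Rightarrow> 'a" and mA :: "'a \<Rightarrow> 'a \<Rightarrow> 'a"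
    and r s :: "('a, 'k) tensor2"
  assumes "assoc_algebra scA mA"
    and "assoc_yang_baxter_pair scA mA r s"
  shows "covariant_bialgebra scA mA
           (inner_derivation scA mA r) (inner_derivation scA mA s)
           (quasitriangular_comult scA mA r s) \<and>
         (\<forall>(scB :: 'k \<Rightarrow> 'b::ab_group_add \<Rightarrow> 'b) (mB :: 'b \<Rightarrow> 'b \<Rightarrow> 'b) (f :: 'a \<Rightarrow> 'b).
            assoc_algebra scB mB \<longrightarrow> algebra_map scA mA scB mB f \<longrightarrow>
            (let rf = tensor_map2 scB f r; sf = tensor_map2 scB f s
             in assoc_yang_baxter_pair scB mB rf sf \<and>
                covariant_bialgebra_morphism
                  scA mA (inner_derivation scA mA r) (inner_derivation scA mA s)
                    (quasitriangular_comult scA mA r s)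
                  scB mB (inner_derivation scB mB rf) (inner_derivation scB mB sf)
                    (quasitriangular_comult scB mB rf sf)
                  f))"
proof (intro conjI allI impI)
  show A: "covariant_bialgebra scA mA (inner_derivation scA mA r) (inner_derivation scA mA s)
      (quasitriangular_comult scA mA r s)"
    by (rule assoc_algebra.covariant_bialgebra_quasitriangular[OF assms])
  fix scB :: "'k \<Rightarrow> 'b::ab_group_add \<Rightarrow> 'b" and mB and f :: "'a \<Rightarrow> 'b"
  assume B: "assoc_algebra scB mB" and f: "algebra_map scA mA scB mB f"
  \<comment> \<open>The transported pair comes first, since it is what makes the target a covariant
    bialgebra.\<close>
  note pair = assoc_yang_baxter_pair_map[OF assms(1) B f assms(2)]
  have "r \<in> tensor_space2 scA" "s \<in> tensor_space2 scA"
    using assms(2) by (simp_all add: assoc_yang_baxter_pair_def)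
  note comult = quasitriangular_comult_map[OF assms(1) B f this]
  show "let rf = tensor_map2 scB f r; sf = tensor_map2 scB f s
    in assoc_yang_baxter_pair scB mB rf sf \<and>
      covariant_bialgebra_morphism
        scA mA (inner_derivation scA mA r) (inner_derivation scA mA s)
          (quasitriangular_comult scA mA r s)
        scB mB (inner_derivation scB mB rf) (inner_derivation scB mB sf)
          (quasitriangular_comult scB mB rf sf)
        f"
    using A pair assoc_algebra.covariant_bialgebra_quasitriangular[OF B pair] f comult
    by (simp add: covariant_bialgebra_morphism_def)
qed

end
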